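(* Let $r\ge 1$ be an integer and $\lambda_r\in\mathbb{C}\setminus\{0,1\}$. Let $\lambda^{dX}_{n,m}$ be the coefficient of $x^m$ in $P^d_n(\lambda_r;r)(x)$ (with $\lambda^{dX}_{0,-1}=0$) and let ${\xi^d}^{(n)}_1,\dots,{\xi^d}^{(n)}_n$ be the zeros of $P^d_n(\lambda_r;r)$. Then: \begin{enumerate} \item $P^d_{2n+1}(\lambda_r;r)(0)=0$, equivalently $\prod_{i=1}^{2n+1}{\xi^d}^{(2n+1)}_i=0$, equivalently $\lambda^{dX}_{2n+1,0}=0$, for $n\ge0$. \item $\lambda^{dX}_{n,n-1}=0=\sum_{i=1}^{n}{\xi^d}^{(n)}_i$ for $n\ge0$. \item If $r=2r'$ is even, then $\lambda^{dX}_{2n,0}=\frac{(-1)^n}{2^{2n}}=\prod_{i=1}^{2n}{\xi^d}^{(2n)}_i$ for $n\ge0$. \item If $r=2r'+1$ is odd, then $$\lambda^{dX}_{2k',0}=\frac{(-1)^{k'}}{2^{2k'}}=\prod_{i=1}^{2k'}{\xi^d}^{(2k')}_i,\quad 0\le k'\le r',$$ $$\lambda^{dX}_{2k',0}=\frac{(-1)^{k'}}{2^{2k'}}\lambda_r=\prod_{i=1}^{2k'}{\xi^d}^{(2k')}_i,\quad r'+1\le k'\le r-1,$$ $$\lambda^{dX}_{2(n+r),0}=-\frac{(-1)^{n}}{2^{2(n+r)}}\lambda_r=\prod_{i=1}^{2(n+r)}{\xi^d}^{(2(n+r))}_i,\quad n\ge0.$$ \item For every $r\ge1$: $P^d_{2n}(\lambda_r;r)(0)\ne0$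 for $n\ge0$. \end{enumerate}
   Context: For an integer $r\ge 1$ and $\lambda_r\in\mathbb{C}\setminus\{0,1\}$, the $r$th-perturbed by dilatation sequence $\{P^d_n(\lambda_r;r)\}_{n\ge 0}$ of the monic Chebyshev polynomials of the second kind is the monic sequence with $P^d_0=1$, $P^d_1(x)=x$, $P^d_{n+2}(x)=xP^d_{n+1}(x)-\gamma_{n+1}P^d_n(x)$ for $n\ge 0$, where $\gamma_r=\lambda_r/4$ and $\gamma_{n+1}=1/4$ for $n\ge 0$, $n\ne r-1$. Zeros are complex zeros listed with multiplicity; empty sums are $0$ and empty products are $1$. *)

theory Defs
  imports Complex_Main "HOL-Computational_Algebra.Computational_Algebra"
begin

text \<open>
  The recurrence coefficients \<open>\<gamma>\<^sub>k\<close>, \<open>k \<ge> 1\<close>, of the perturbed sequence. For the unperturbed monic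
  Chebyshev polynomials of the second kind all of them equal \<open>1/4\<close>; the dilatation multiplies the
  one of index \<open>r\<close> by \<open>\<lambda>\<^sub>r\<close>. The value at \<open>k = 0\<close> is never used.
\<close>

definition gamma_dil :: "complex \<Rightarrow> nat \<Rightarrow> nat \<Rightarrow> complex" where
  "gamma_dil lam r k = (if k = r then lam / 4 else 1 / 4)"

fun P_dil :: "complex \<Rightarrow> nat \<Rightarrow> nat \<Rightarrow> complex poly" where
  "P_dil lam r 0 = 1"
| "P_dil lam r (Suc 0) = [:0, 1:]"
| "P_dil lam r (Suc (Suc n)) =
     [:0, 1:] * P_dil lam r (Suc n) - smult (gamma_dil lam r (n + 1)) (P_dil lam r n)"

text \<open>
  The index \<open>m\<close> is an integer because of the convention that the coefficient with \<open>n = 0\<close>, \<open>m = -1\<close>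
  is \<open>0\<close>.
\<close>

definition coeff_dil :: "complex \<Rightarrow> nat \<Rightarrow> nat \<Rightarrow> int \<Rightarrow> complex" where
  "coeff_dil lam r n m = (if m < 0 then 0 else coeff (P_dil lam r n) (nat m))"

text \<open>
  \<open>\<xi> 1, \<dots>, \<xi> n\<close> is an enumeration, with multiplicity, of the complex zeros of \<open>P_dil lam r n\<close>.
\<close>

definition lists_zeros_dil :: "complex \<Rightarrow> nat \<Rightarrow> nat \<Rightarrow> (nat \<Rightarrow> complex) \<Rightarrow> bool" where
  "lists_zeros_dil lam r n \<xi> \<longleftrightarrow> image_mset \<xi> (mset_set {1..n}) = proots (P_dil lam r n)"

lemma degree_P_dil: "degree (P_dil lam r n) = n \<and> lead_coeff (P_dil lam r n) = 1"
proof (induction n rule: less_induct)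
  case (less n)
  consider "n = 0" | "n = 1" | m where "n = Suc (Suc m)"
    by (metis One_nat_def not0_implies_Suc)
  then show ?case
  proof cases
    case 3
    let ?a = "[:0, 1:] * P_dil lam r (Suc m)"
    let ?b = "smult (gamma_dil lam r (m + 1)) (P_dil lam r m)"
    have S: "degree (P_dil lam r (Suc m)) = Suc m" "lead_coeff (P_dil lam r (Suc m)) = 1"
      and M: "degree (P_dil lam r m) = m"
      using less.IH[of "Suc m"] less.IH[of m] 3 by auto
    have nz: "P_dil lam r (Suc m) \<noteq> 0" using S by auto
    have a: "degree ?a = Suc (Suc m)" using nz S by simp
    have b: "degree ?b < Suc (Suc m)" using M degree_smult_le[of _ "P_dil lam r m"]
      by (metis le_imp_less_Suc less_SucI)
    have d: "degree (?a + - ?b) = Suc (Suc m)"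
      by (subst degree_add_eq_left) (use a b in simp_all)
    moreover have "coeff (?a - ?b) (Suc (Suc m)) = 1"
      using S(2)[unfolded S(1)] coeff_eq_0[OF b] by simp
    ultimately show ?thesis using 3 by simp
  qed simp_all
qed

lemma ex_lists_zeros_dil: "\<exists>\<xi>. lists_zeros_dil lam r n \<xi>"
proof -
  obtain xs where xs: "mset xs = proots (P_dil lam r n)" by (metis ex_mset)
  then have len: "length xs = n"
    using size_proots_complex[of "P_dil lam r n"] degree_P_dil by (metis size_mset)
  have "image_mset (\<lambda>i. xs ! (i - 1)) (mset_set {1..n}) = mset xs"
  proof -
    have "mset_set {1..n} = mset [1..<Suc n]"
      by (metis atLeastLessThanSuc_atLeastAtMost mset_upt)
    moreover have "map (\<lambda>i. xs ! (i - 1)) [1..<Suc n] = xs"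
      using len by (intro nth_equalityI) (auto simp del: upt_Suc)
    ultimately show ?thesis by (metis mset_map)
  qed
  with xs show ?thesis unfolding lists_zeros_dil_def by metis
qed

end

theory Submission
  imports Defs
begin

text \<open>
  At \<open>x = 0\<close> the recurrence collapses to \<open>P\<^sub>n\<^sub>+\<^sub>2(0) = -\<gamma>\<^sub>n\<^sub>+\<^sub>1 P\<^sub>n(0)\<close>, so \<open>P\<^sub>2\<^sub>n(0)\<close> is the product of the
  numbers \<open>-\<gamma>\<^sub>k\<close> over the odd \<open>k < 2n\<close>; the perturbed coefficient \<open>\<gamma>\<^sub>r\<close> occurs in it iff \<open>r\<close> is odd and
  \<open>r < 2n\<close>. Moreover \<open>P\<^sub>n\<close> has the parity of \<open>n\<close>, which kills \<open>P\<^sub>2\<^sub>n\<^sub>+\<^sub>1(0)\<close> and the coefficient of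
  \<open>x\<^sup>n\<^sup>-\<^sup>1\<close>. The statements on zeros follow by Vieta's formulas for the constant and the second coefficient.
\<close>

lemma coeff_0_prod_mset_linear:
  fixes M :: "'a::comm_ring_1 multiset"
  shows "coeff (\<Prod>x\<in>#M. [:- x, 1:]) 0 = (- 1) ^ size M * prod_mset M"
  by (induction M) (simp_all add: mult_ac)

text \<open>Being monic is what Vieta's formula for the second coefficient needs: a further factor x
  - a contributes -a times the leading coefficient. The vanishing above \<open>size M\<close>
  carries the induction.\<close>

lemma coeff_prod_mset_linear_size:
  fixes M :: "'a::comm_ring_1 multiset"
  shows "coeff (\<Prod>x\<in>#M. [:- x, 1:]) (size M) = 1
    \<and> (\<forall>k>size M. coeff (\<Prod>x\<in>#M. [:- x, 1:]) k = 0)"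
proof (induction M)
  case empty
  show ?case by (simp add: coeff_eq_0)
next
  case (add a M)
  then show ?case by (auto simp: coeff_pCons split: nat.split)
qed

text \<open>The shift by \<open>pCons 0\<close> covers the empty multiset, where the coefficient of index \<open>-1\<close> is meant.\<close>

lemma coeff_pCons_prod_mset_linear:
  fixes M :: "'a::comm_ring_1 multiset"
  shows "coeff (pCons 0 (\<Prod>x\<in>#M. [:- x, 1:])) (size M) = - sum_mset M"
proof (induction M)
  case (add a M)
  then show ?case using coeff_prod_mset_linear_size[of M] by simp
qed simp

lemma P_dil_eq_prod_zeros: "(\<Prod>x\<in>#proots (P_dil lam r n). [:- x, 1:]) = P_dil lam r n"
  using complex_poly_decompose_multiset[of "P_dil lam r n"] degree_P_dil[of lam r n]
  by (metis smult_1_left)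

lemma size_proots_P_dil: "size (proots (P_dil lam r n)) = n"
  using size_proots_complex[of "P_dil lam r n"] degree_P_dil[of lam r n] by simp

lemma prod_zeros_dil:
  assumes "lists_zeros_dil lam r n \<xi>"
  shows "(\<Prod>i = 1..n. \<xi> i) = (- 1) ^ n * coeff (P_dil lam r n) 0"
proof -
  have "(\<Prod>i = 1..n. \<xi> i) = prod_mset (proots (P_dil lam r n))"
    using assms unfolding lists_zeros_dil_def prod_unfold_prod_mset by metis
  moreover have "coeff (P_dil lam r n) 0 = (- 1) ^ n * prod_mset (proots (P_dil lam r n))"
    using coeff_0_prod_mset_linear[of "proots (P_dil lam r n)"]
    by (simp only: P_dil_eq_prod_zeros size_proots_P_dil)
  ultimately show ?thesis by (simp flip: mult.assoc power_add)
qed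

lemma sum_zeros_dil:
  assumes "lists_zeros_dil lam r n \<xi>"
  shows "(\<Sum>i = 1..n. \<xi> i) = - coeff_dil lam r n (int n - 1)"
proof -
  have "(\<Sum>i = 1..n. \<xi> i) = sum_mset (proots (P_dil lam r n))"
    using assms unfolding lists_zeros_dil_def sum_unfold_sum_mset by metis
  moreover have "coeff (pCons 0 (P_dil lam r n)) n = - sum_mset (proots (P_dil lam r n))"
    using coeff_pCons_prod_mset_linear[of "proots (P_dil lam r n)"]
    by (simp only: P_dil_eq_prod_zeros size_proots_P_dil)
  moreover have "coeff_dil lam r n (int n - 1) = coeff (pCons 0 (P_dil lam r n)) n"
    by (cases n) (simp_all add: coeff_dil_def)
  ultimately show ?thesis by simp
qed

text \<open>Multiplication by x shifts both degree and index by one, and the subtracted term has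
  degree lower by two, so the recurrence respects parity.\<close>

lemma coeff_P_dil_parity: "odd (n + m) \<Longrightarrow> coeff (P_dil lam r n) m = 0"
proof (induction lam r n arbitrary: m rule: P_dil.induct)
  case (1 lam r)
  then show ?case by (cases m) simp_all
next
  case (2 lam r)
  then show ?case by (auto simp: coeff_pCons split: nat.split)
next
  case (3 lam r n)
  then show ?case by (cases m) simp_all
qed

lemma coeff_0_P_dil_even:
  "coeff (P_dil lam r (2 * n)) 0 =
    (- 1) ^ n / 2 ^ (2 * n) * (if odd r \<and> r < 2 * n then lam else 1)"
proof (induction n)
  case (Suc n)
  \<comment> \<open>The new factor is minus the recurrence coefficient of index 2n + 1, which is
    perturbed exactly when r = 2n + 1.\<close>
  have "odd r \<Longrightarrow> r < 2 * Suc n \<longleftrightarrow> r < 2 * n \<or> r = 2 * n + 1" by presburger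
  then show ?case using Suc by (auto simp: gamma_dil_def)
qed simp

theorem proposition5p5:
  fixes r :: nat and lam :: complex and \<xi> :: "nat \<Rightarrow> nat \<Rightarrow> complex"
  assumes "r \<ge> 1"
    and "lam \<noteq> 0" and "lam \<noteq> 1"
    and "\<And>n. lists_zeros_dil lam r n (\<xi> n)"
  shows
    "(\<forall>n::nat. poly (P_dil lam r (2 * n + 1)) 0 = 0
        \<and> (poly (P_dil lam r (2 * n + 1)) 0 = 0 \<longleftrightarrow> (\<Prod>i = 1..2 * n + 1. \<xi> (2 * n + 1) i) = 0)
        \<and> ((\<Prod>i = 1..2 * n + 1. \<xi> (2 * n + 1) i) = 0 \<longleftrightarrow> coeff_dil lam r (2 * n + 1) 0 = 0))
   \<and> (\<forall>n::nat. coeff_dil lam r n (int n - 1) = 0 \<and> 0 = (\<Sum>i = 1..n. \<xi> n i))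
   \<and> (\<forall>r'::nat. r = 2 * r' \<longrightarrow>
        (\<forall>n::nat. coeff_dil lam r (2 * n) 0 = (- 1) ^ n / 2 ^ (2 * n)
          \<and> (- 1) ^ n / 2 ^ (2 * n) = (\<Prod>i = 1..2 * n. \<xi> (2 * n) i)))
   \<and> (\<forall>r'::nat. r = 2 * r' + 1 \<longrightarrow>
        (\<forall>k'::nat. k' \<le> r' \<longrightarrow>
            coeff_dil lam r (2 * k') 0 = (- 1) ^ k' / 2 ^ (2 * k')
          \<and> (- 1) ^ k' / 2 ^ (2 * k') = (\<Prod>i = 1..2 * k'. \<xi> (2 * k') i))
      \<and> (\<forall>k'::nat. r' + 1 \<le> k' \<and> k' \<le> r - 1 \<longrightarrow>
            coeff_dil lam r (2 * k') 0 = (- 1) ^ k' / 2 ^ (2 * k') * lam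
          \<and> (- 1) ^ k' / 2 ^ (2 * k') * lam = (\<Prod>i = 1..2 * k'. \<xi> (2 * k') i))
      \<and> (\<forall>n::nat. coeff_dil lam r (2 * (n + r)) 0 = - ((- 1) ^ n / 2 ^ (2 * (n + r))) * lam
          \<and> - ((- 1) ^ n / 2 ^ (2 * (n + r))) * lam
              = (\<Prod>i = 1..2 * (n + r). \<xi> (2 * (n + r)) i)))
   \<and> (\<forall>n::nat. poly (P_dil lam r (2 * n)) 0 \<noteq> 0)"
proof -
  have c0: "coeff_dil lam r k 0 = coeff (P_dil lam r k) 0" for k
    by (simp add: coeff_dil_def)
  have prod: "(\<Prod>i = 1..k. \<xi> k i) = (- 1) ^ k * coeff (P_dil lam r k) 0" for k
    using prod_zeros_dil assms(4) .
  have odd0: "coeff (P_dil lam r (2 * n + 1)) 0 = 0" for n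
    by (rule coeff_P_dil_parity) simp
  have subleading: "coeff_dil lam r n (int n - 1) = 0" for n
    \<comment> \<open>For n = 0 this is the convention at index -1; otherwise n + (n - 1) is
      odd.\<close>
    by (cases n) (simp_all add: coeff_dil_def coeff_P_dil_parity)
  have even_prod: "(\<Prod>i = 1..2 * n. \<xi> (2 * n) i) = coeff (P_dil lam r (2 * n)) 0" for n
    using prod[of "2 * n"] by simp
  have odd_prod: "(\<Prod>i = 1..2 * n + 1. \<xi> (2 * n + 1) i) = 0" for n
    by (simp only: prod odd0 mult_zero_right)
  have sum: "(\<Sum>i = 1..n. \<xi> n i) = 0" for n
    using sum_zeros_dil[OF assms(4)] subleading by simp
  \<comment> \<open>This is the source of the minus sign in the formula for index 2(n + r).\<close>
  have sign: "(- 1 :: complex) ^ (n + r) = - ((- 1) ^ n)" if "odd r" for n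
    using that by (simp add: power_add)
  \<comment> \<open>For r = 2r' + 1 the condition r < 2k says k > r', which separates the ranges and
    always holds for k = n + r. Nonvanishing at 0 comes from \<open>lam\<close> being
    nonzero.\<close>
  show ?thesis
    unfolding c0 poly_0_coeff_0 even_prod odd_prod odd0 coeff_0_P_dil_even subleading sum
    using assms(2) sign by auto
qed

end
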